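(* Let $U\subset\mathbb{H}$ be a region. A function $F\colon U\to\mathbb{H}$ is (left) skew regular on $U$ if and only if it is symmetrically analytic on $U$.
   Context: $\mathbb{H}$ is the skew field of quaternions with its Euclidean topology, $\mathbb{H}^*=\mathbb{H}\setminus\{0\}$. $\mathbb{H}^*$ acts on $\mathbb{H}$ by ${}^{p}q=pqp^{-1}$; $O(q)$ is the orbit of $q$. An orbit is trivial if it is a single (real) point and nontrivial otherwise (then it is a 2-sphere). A region is a subset of $\mathbb{H}$ that is open and invariant under this action. $T$ denotes the identity function of $\mathbb{H}$, and a constant function is denoted by its value. Skew product: for $F,G\colon U\to\mathbb{H}$ on an invariant set $U$, $(F\diamond G)(x)=F({}^{G(x)}x)\,G(x)$ if $G(x)\neq0$, and $(F\diamond G)(x)=0$ if $G(x)=0$. In particular $(S\diamond T)(q)=S(q)q$. Skew regularity: $F\colon U\to\mathbb{H}$ on a region $U$ is skew differentiable at $q\in U$ if there is a function $\mathcal{D}_q(F)\colon U\to\mathbb{H}$ that is continuous at all $p\in O(q)$ and satisfies $F=F(q)+\mathcal{D}_q(F)\diamond(T-q)$ as functions on $U$. $F$ is skew regular on $U$ if it is skew differentiable at all points of $U$. Spherical series: for a trivial orbit $O=\{r\}$ put $P_O(T)=T-r$; for a nontrivial orbit $O$ put $P_O(T)=T^2-2\mathrm{Re}(p)T+|p|^2$ for any $p\in O$ (independent of $p$). A spherical series centered at $O$ is a formal series $S(T)=\sum_{n=0}^\infty q_nP_O(T)^n$ with $q_n\in\mathbb{H}$; its value at $q\in\mathbb{H}$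 is $S(q)=\sum_{n=0}^\infty q_nP_O(q)^n$ whenever this converges. Symmetric analyticity: $F\colon U\to\mathbb{H}$ on a region $U$ is symmetrically analytic if for every orbit $O\subset U$: (1) if $O$ is trivial, there is a spherical series $S(T)$ centered at $O$, convergent in a neighborhood $V\subset U$ of $O$, with $F=S(T)$ as functions on $V$; (2) if $O$ is nontrivial, there are spherical series $S_1(T),S_2(T)$ centered at $O$, convergent in a neighborhood $V\subset U$ of $O$, with $F=S_1(T)+S_2(T)\diamond T$ as functions on $V$. *)

theory Defs
  imports "HOL-Analysis.Analysis"
begin

section \<open>The skew field of quaternions\<close>

text \<open>\<open>Quat a b c d\<close> is the quaternion \<open>a + b i + c j + d k\<close>, where
  \<open>i\<^sup>2 = j\<^sup>2 = k\<^sup>2 = i j k = - 1\<close>.\<close>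

datatype quat = Quat (qRe: real) (qIm1: real) (qIm2: real) (qIm3: real)

lemma quat_eq_iff:
  "x = y \<longleftrightarrow> qRe x = qRe y \<and> qIm1 x = qIm1 y \<and> qIm2 x = qIm2 y \<and> qIm3 x = qIm3 y"
  by (cases x; cases y) simp

instantiation quat :: ab_group_add
begin

definition zero_quat :: quat where
  "0 = Quat 0 0 0 0"

definition plus_quat :: "quat \<Rightarrow> quat \<Rightarrow> quat" where
  "x + y = Quat (qRe x + qRe y) (qIm1 x + qIm1 y) (qIm2 x + qIm2 y) (qIm3 x + qIm3 y)"

definition uminus_quat :: "quat \<Rightarrow> quat" where
  "- x = Quat (- qRe x) (- qIm1 x) (- qIm2 x) (- qIm3 x)"

definition minus_quat :: "quat \<Rightarrow> quat \<Rightarrow> quat" where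
  "x - y = Quat (qRe x - qRe y) (qIm1 x - qIm1 y) (qIm2 x - qIm2 y) (qIm3 x - qIm3 y)"

instance
  by standard (simp_all add: quat_eq_iff zero_quat_def plus_quat_def uminus_quat_def minus_quat_def)

end

lemma quat_zero_sel [simp]: "qRe 0 = 0" "qIm1 0 = 0" "qIm2 0 = 0" "qIm3 0 = 0"
  by (simp_all add: zero_quat_def)

lemma quat_add_sel [simp]:
  "qRe (x + y) = qRe x + qRe y" "qIm1 (x + y) = qIm1 x + qIm1 y"
  "qIm2 (x + y) = qIm2 x + qIm2 y" "qIm3 (x + y) = qIm3 x + qIm3 y"
  by (simp_all add: plus_quat_def)

lemma quat_uminus_sel [simp]:
  "qRe (- x) = - qRe x" "qIm1 (- x) = - qIm1 x" "qIm2 (- x) = - qIm2 x" "qIm3 (- x) = - qIm3 x"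
  by (simp_all add: uminus_quat_def)

lemma quat_diff_sel [simp]:
  "qRe (x - y) = qRe x - qRe y" "qIm1 (x - y) = qIm1 x - qIm1 y"
  "qIm2 (x - y) = qIm2 x - qIm2 y" "qIm3 (x - y) = qIm3 x - qIm3 y"
  by (simp_all add: minus_quat_def)

instantiation quat :: ring_1
begin

definition one_quat :: quat where
  "1 = Quat 1 0 0 0"

definition times_quat :: "quat \<Rightarrow> quat \<Rightarrow> quat" where
  "x * y = Quat
    (qRe x * qRe y - qIm1 x * qIm1 y - qIm2 x * qIm2 y - qIm3 x * qIm3 y)
    (qRe x * qIm1 y + qIm1 x * qRe y + qIm2 x * qIm3 y - qIm3 x * qIm2 y)
    (qRe x * qIm2 y - qIm1 x * qIm3 y + qIm2 x * qRe y + qIm3 x * qIm1 y)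
    (qRe x * qIm3 y + qIm1 x * qIm2 y - qIm2 x * qIm1 y + qIm3 x * qRe y)"

instance
proof
  fix x y z :: quat
  show "x * y * z = x * (y * z)"
    unfolding quat_eq_iff times_quat_def quat.sel by (intro conjI; algebra)
  show "(x + y) * z = x * z + y * z" "x * (y + z) = x * y + x * z"
    unfolding quat_eq_iff times_quat_def quat_add_sel quat.sel by (intro conjI; algebra)+
qed (simp_all add: quat_eq_iff one_quat_def times_quat_def)

end

lemma quat_one_sel [simp]: "qRe 1 = 1" "qIm1 1 = 0" "qIm2 1 = 0" "qIm3 1 = 0"
  by (simp_all add: one_quat_def)

lemma quat_mult_sel [simp]:
  "qRe (x * y) = qRe x * qRe y - qIm1 x * qIm1 y - qIm2 x * qIm2 y - qIm3 x * qIm3 y"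
  "qIm1 (x * y) = qRe x * qIm1 y + qIm1 x * qRe y + qIm2 x * qIm3 y - qIm3 x * qIm2 y"
  "qIm2 (x * y) = qRe x * qIm2 y - qIm1 x * qIm3 y + qIm2 x * qRe y + qIm3 x * qIm1 y"
  "qIm3 (x * y) = qRe x * qIm3 y + qIm1 x * qIm2 y - qIm2 x * qIm1 y + qIm3 x * qRe y"
  by (simp_all add: times_quat_def)

instantiation quat :: real_algebra_1
begin

definition scaleR_quat :: "real \<Rightarrow> quat \<Rightarrow> quat" where
  "scaleR r x = Quat (r * qRe x) (r * qIm1 x) (r * qIm2 x) (r * qIm3 x)"

instance
  by standard (simp_all add: quat_eq_iff scaleR_quat_def algebra_simps)

end

lemma quat_scaleR_sel [simp]:
  "qRe (scaleR r x) = r * qRe x" "qIm1 (scaleR r x) = r * qIm1 x"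
  "qIm2 (scaleR r x) = r * qIm2 x" "qIm3 (scaleR r x) = r * qIm3 x"
  by (simp_all add: scaleR_quat_def)

lemma quat_of_real_sel [simp]:
  "qRe (of_real r) = r" "qIm1 (of_real r) = 0" "qIm2 (of_real r) = 0" "qIm3 (of_real r) = 0"
  by (simp_all add: of_real_def)

instantiation quat :: real_inner
begin

definition inner_quat :: "quat \<Rightarrow> quat \<Rightarrow> real" where
  "inner x y = qRe x * qRe y + qIm1 x * qIm1 y + qIm2 x * qIm2 y + qIm3 x * qIm3 y"

definition norm_quat :: "quat \<Rightarrow> real" where
  "norm x = sqrt ((qRe x)\<^sup>2 + (qIm1 x)\<^sup>2 + (qIm2 x)\<^sup>2 + (qIm3 x)\<^sup>2)"

definition sgn_quat :: "quat \<Rightarrow> quat" where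
  "sgn x = scaleR (inverse (norm (x::quat))) x"

definition dist_quat :: "quat \<Rightarrow> quat \<Rightarrow> real" where
  "dist x y = norm (x - (y::quat))"

definition uniformity_quat :: "(quat \<times> quat) filter" where
  "uniformity = (INF e\<in>{0<..}. principal {(x::quat, y). dist x y < e})"

definition open_quat :: "quat set \<Rightarrow> bool" where
  "open (S :: quat set) \<longleftrightarrow> (\<forall>x\<in>S. \<forall>\<^sub>F (x', y) in uniformity. x' = x \<longrightarrow> y \<in> S)"

instance
proof
  fix x y z :: quat and r :: real and S :: "quat set"
  show "inner x y = inner y x" "inner (x + y) z = inner x z + inner y z"
    "inner (scaleR r x) y = r * inner x y"
    by (simp_all add: inner_quat_def algebra_simps)
  show "0 \<le> inner x x"
    by (simp add: inner_quat_def)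
  show "inner x x = 0 \<longleftrightarrow> x = 0"
    by (auto simp: inner_quat_def quat_eq_iff add_nonneg_eq_0_iff)
  show "norm x = sqrt (inner x x)"
    by (simp add: inner_quat_def norm_quat_def power2_eq_square)
qed (rule dist_quat_def sgn_quat_def uniformity_quat_def open_quat_def)+

end

lemma norm_quat_squared:
  "(norm (x::quat))\<^sup>2 = (qRe x)\<^sup>2 + (qIm1 x)\<^sup>2 + (qIm2 x)\<^sup>2 + (qIm3 x)\<^sup>2"
  by (simp add: norm_quat_def)

text \<open>The inverse is the conjugate divided by the squared norm.\<close>

instantiation quat :: real_normed_div_algebra
begin

definition inverse_quat :: "quat \<Rightarrow> quat" where
  "inverse x = scaleR (1 / (norm x)\<^sup>2) (Quat (qRe x) (- qIm1 x) (- qIm2 x) (- qIm3 x))"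

definition divide_quat :: "quat \<Rightarrow> quat \<Rightarrow> quat" where
  "x div (y::quat) = x * inverse y"

instance
proof
  fix x y :: quat
  show "inverse x * x = 1" "x * inverse x = 1" if "x \<noteq> 0"
  proof -
    define n where "n = (norm x)\<^sup>2"
    have "n \<noteq> 0"
      using that by (simp add: n_def)
    moreover have "n = qRe x * qRe x + qIm1 x * qIm1 x + qIm2 x * qIm2 x + qIm3 x * qIm3 x"
      unfolding n_def norm_quat_squared by (simp add: power2_eq_square)
    ultimately show "inverse x * x = 1" "x * inverse x = 1"
      by (simp_all add: quat_eq_iff inverse_quat_def flip: n_def)
  qed
  show "x div y = x * inverse y"
    by (rule divide_quat_def)
  show "inverse (0::quat) = 0"
    by (simp add: inverse_quat_def quat_eq_iff)
  have "(norm (x * y))\<^sup>2 = (norm x * norm y)\<^sup>2"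
    unfolding power_mult_distrib norm_quat_squared quat_mult_sel by algebra
  then show "norm (x * y) = norm x * norm y"
    by (simp add: power2_eq_iff_nonneg)
qed

end

instantiation quat :: euclidean_space
begin

definition Basis_quat :: "quat set" where
  "Basis = {Quat 1 0 0 0, Quat 0 1 0 0, Quat 0 0 1 0, Quat 0 0 0 1}"

instance
proof
  fix u v x :: quat
  show "(Basis :: quat set) \<noteq> {}" "finite (Basis :: quat set)"
    by (simp_all add: Basis_quat_def)
  show "inner u v = (if u = v then 1 else 0)" if "u \<in> Basis" "v \<in> Basis"
    using that unfolding Basis_quat_def by (elim insertE emptyE) (simp_all add: inner_quat_def)
  show "(\<forall>u\<in>Basis. inner x u = 0) \<longleftrightarrow> x = 0"
    by (simp add: Basis_quat_def inner_quat_def quat_eq_iff[of x 0])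
qed

end


section \<open>The conjugation action\<close>

definition conj_act :: "quat \<Rightarrow> quat \<Rightarrow> quat" where
  "conj_act p q = p * q * inverse p"

definition orbit :: "quat \<Rightarrow> quat set" where
  "orbit q = {conj_act p q | p. p \<noteq> 0}"

definition trivial_orbit :: "quat set \<Rightarrow> bool" where
  "trivial_orbit S \<longleftrightarrow> (\<exists>r. S = {r})"

definition region :: "quat set \<Rightarrow> bool" where
  "region U \<longleftrightarrow> open U \<and> (\<forall>p q. p \<noteq> 0 \<longrightarrow> q \<in> U \<longrightarrow> conj_act p q \<in> U)"

lemma self_in_orbit: "q \<in> orbit q"
  unfolding orbit_def conj_act_def by (rule CollectI, rule exI[of _ 1]) simp

lemma qRe_mult_commute: "qRe (x * y) = qRe (y * x)"
  by (simp add: algebra_simps)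

lemma qRe_conj_act: "qRe (conj_act p q) = qRe q" if "p \<noteq> 0"
proof -
  have "qRe (conj_act p q) = qRe (inverse p * (p * q))"
    unfolding conj_act_def by (rule qRe_mult_commute)
  also have "inverse p * (p * q) = q"
    using that by (simp flip: mult.assoc)
  finally show ?thesis .
qed

lemma norm_conj_act: "norm (conj_act p q) = norm q" if "p \<noteq> 0"
  using that by (simp add: conj_act_def norm_mult norm_inverse)

lemma trivial_orbit_iff: "trivial_orbit (orbit q) \<longleftrightarrow> q \<in> \<real>"
proof
  assume "q \<in> \<real>"
  then have "p * q * inverse p = q" if "p \<noteq> 0" for p
    using that by (elim Reals_cases) (simp add: of_real_def)
  then have "orbit q \<subseteq> {q}"
    by (auto simp: orbit_def conj_act_def)
  then show "trivial_orbit (orbit q)"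
    unfolding trivial_orbit_def using self_in_orbit[of q] by blast
next
  assume "trivial_orbit (orbit q)"
  then have eq: "orbit q = {q}"
    using self_in_orbit[of q] by (auto simp: trivial_orbit_def)
  have comm: "p * q = q * p" if "p \<noteq> 0" for p
  proof -
    have "conj_act p q \<in> orbit q"
      using that by (auto simp: orbit_def)
    then have "p * q * inverse p = q"
      using eq by (simp add: conj_act_def)
    then have "p * q * inverse p * p = q * p"
      by simp
    then show ?thesis
      using that by (simp add: mult.assoc)
  qed
  have "q = of_real (qRe q)"
    using comm[of "Quat 0 1 0 0"] comm[of "Quat 0 0 1 0"] by (simp add: quat_eq_iff)
  then show "q \<in> \<real>"
    by (metis Reals_of_real)
qed


section \<open>Skew regular functions\<close>

text \<open>A function on \<open>U\<close> is represented by a total function on the quaternions of which only the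
  values on \<open>U\<close> matter. In the skew product this is consistent because \<open>U\<close> is invariant.\<close>

definition skew_prod :: "(quat \<Rightarrow> quat) \<Rightarrow> (quat \<Rightarrow> quat) \<Rightarrow> quat \<Rightarrow> quat"  (infixl "\<diamondop>" 70) where
  "(F \<diamondop> G) x = (if G x = 0 then 0 else F (conj_act (G x) x) * G x)"

definition skew_differentiable :: "(quat \<Rightarrow> quat) \<Rightarrow> quat set \<Rightarrow> quat \<Rightarrow> bool" where
  "skew_differentiable F U q \<longleftrightarrow>
    (\<exists>D. (\<forall>p\<in>orbit q. continuous (at p within U) D) \<and>
         (\<forall>x\<in>U. F x = F q + (D \<diamondop> (\<lambda>y. y - q)) x))"

definition skew_regular_on :: "quat set \<Rightarrow> (quat \<Rightarrow> quat) \<Rightarrow> bool" where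
  "skew_regular_on U F \<longleftrightarrow> (\<forall>q\<in>U. skew_differentiable F U q)"


section \<open>Spherical series and symmetrically analytic functions\<close>

text \<open>The choice of the representative \<open>p\<close> of the orbit \<open>S\<close> is irrelevant, by
  \<open>orbit_poly_trivial\<close> and \<open>orbit_poly_nontrivial\<close> below.\<close>

definition orbit_poly :: "quat set \<Rightarrow> quat \<Rightarrow> quat" where
  "orbit_poly S x =
    (let p = (SOME p. p \<in> S) in
     if trivial_orbit S then x - p
     else x\<^sup>2 - of_real (2 * qRe p) * x + of_real ((norm p)\<^sup>2))"

lemma orbit_poly_trivial: "orbit_poly {r} x = x - r"
  by (simp add: orbit_poly_def trivial_orbit_def)

lemma orbit_poly_nontrivial:
  assumes "S \<in> range orbit" "\<not> trivial_orbit S" "p \<in> S"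
  shows "orbit_poly S x = x\<^sup>2 - of_real (2 * qRe p) * x + of_real ((norm p)\<^sup>2)"
proof -
  define p' where "p' = (SOME p. p \<in> S)"
  have "p' \<in> S"
    unfolding p'_def using assms(3) by (rule someI)
  then have "qRe p' = qRe p" "norm p' = norm p"
    using assms(1,3) by (auto simp: orbit_def qRe_conj_act norm_conj_act)
  then show ?thesis
    using assms(2) by (simp add: orbit_poly_def flip: p'_def)
qed

text \<open>A spherical series is given by its sequence of coefficients \<open>a\<close>.\<close>

definition spherical_series :: "quat set \<Rightarrow> (nat \<Rightarrow> quat) \<Rightarrow> quat \<Rightarrow> quat" where
  "spherical_series S a x = (\<Sum>n. a n * orbit_poly S x ^ n)"

definition spherical_convergent_on :: "quat set \<Rightarrow> (nat \<Rightarrow> quat) \<Rightarrow> quat set \<Rightarrow> bool" where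
  "spherical_convergent_on S a V \<longleftrightarrow> (\<forall>x\<in>V. summable (\<lambda>n. a n * orbit_poly S x ^ n))"

definition symmetrically_analytic_on :: "quat set \<Rightarrow> (quat \<Rightarrow> quat) \<Rightarrow> bool" where
  "symmetrically_analytic_on U F \<longleftrightarrow>
    (\<forall>S \<in> range orbit. S \<subseteq> U \<longrightarrow>
      (trivial_orbit S \<longrightarrow>
        (\<exists>a V. open V \<and> S \<subseteq> V \<and> V \<subseteq> U \<and>
          spherical_convergent_on S a V \<and>
          (\<forall>x\<in>V. F x = spherical_series S a x))) \<and>
      (\<not> trivial_orbit S \<longrightarrow>
        (\<exists>a b V. open V \<and> S \<subseteq> V \<and> V \<subseteq> U \<and>
          spherical_convergent_on S a V \<and> spherical_convergent_on S b V \<and>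
          (\<forall>x\<in>V. F x = spherical_series S a x + (spherical_series S b \<diamondop> (\<lambda>y. y)) x))))"

end

theory Submission
  imports Defs "HOL-Complex_Analysis.Cauchy_Integral_Formula"
begin

text \<open>On the orbit of \<open>q\<close>, the skew product with \<open>T - q\<close> evaluates \<open>D\<close> only at the conjugate of \<open>q\<close>, so
  a skew regular function is affine on every orbit and is determined by its restriction to one
  complex slice. There the skew quotient is an ordinary difference quotient, so the restriction is
  holomorphic. Near a nonreal orbit the quadratic \<open>P\<close> has two holomorphic local inverses \<open>g1\<close>, \<open>g2\<close>;
  solving \<open>f (g\<^sub>i t) = A t + B t g\<^sub>i t\<close> for holomorphic \<open>A\<close> and \<open>B\<close> and expanding them at \<open>t = 0\<close> gives
  the two spherical series.

  Conversely, the substitution \<open>y = (x - q) x (x - q)\<^sup>-\<^sup>1\<close> has the inverse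
  \<open>x = (y - c) y (y - c)\<^sup>-\<^sup>1\<close> with \<open>c\<close> the conjugate of \<open>q\<close>, and \<open>P x = (y - c) (x - q)\<close>. Dividing the
  series of \<open>F - F q\<close> by \<open>x - q\<close> therefore yields
  \<open>D y = b\<^sub>0 + A\<^sub>1 (P x) (y - c) + B\<^sub>1 (P x) (y - c) y\<close>, which is continuous on the orbit since
  \<open>P x\<close> and \<open>P y\<close> have the same norm.\<close>

section \<open>Complex slices of the quaternions\<close>

definition slice :: "quat \<Rightarrow> complex \<Rightarrow> quat" where
  "slice I z = of_real (Re z) + of_real (Im z) * I"

definition qi :: quat where
  "qi = Quat 0 1 0 0"

definition qj :: quat where
  "qj = Quat 0 0 1 0"

lemma quat_of_real_mult: "of_real r * (x::quat) = scaleR r x"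
  by (simp add: of_real_def)

lemma quat_of_real_commute: "(x::quat) * of_real r = of_real r * x"
  by (simp add: of_real_def)

lemma quat_numeral_sel [simp]:
  "qRe (numeral n) = numeral n" "qIm1 (numeral n) = 0"
  "qIm2 (numeral n) = 0" "qIm3 (numeral n) = 0"
  using quat_of_real_sel[of "numeral n"] by simp_all

lemma qi_square: "qi * qi = - 1"
  by (simp add: quat_eq_iff qi_def)

text \<open>The norm is multiplicative, so \<open>I\<close> has norm 1. Adding this to the real part
  of \<open>I * I = - 1\<close> cancels the imaginary squares and leaves
  \<open>(qRe I)^2 = 0\<close>.\<close>

lemma imaginary_unit_sel:
  assumes "I * I = - 1"
  shows "qRe I = 0" "(qIm1 I)\<^sup>2 + (qIm2 I)\<^sup>2 + (qIm3 I)\<^sup>2 = 1"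
proof -
  have "(norm I)\<^sup>2 = norm (I * I)"
    by (simp add: norm_mult power2_eq_square)
  then have n: "(qRe I)\<^sup>2 + (qIm1 I)\<^sup>2 + (qIm2 I)\<^sup>2 + (qIm3 I)\<^sup>2 = 1"
    using assms by (simp add: norm_quat_squared)
  have "qRe (I * I) = - 1"
    using assms by simp
  then have "(qRe I)\<^sup>2 - (qIm1 I)\<^sup>2 - (qIm2 I)\<^sup>2 - (qIm3 I)\<^sup>2 = - 1"
    by (simp add: power2_eq_square)
  with n have "(qRe I)\<^sup>2 = 0"
    by linarith
  then show "qRe I = 0"
    by simp
  with n show "(qIm1 I)\<^sup>2 + (qIm2 I)\<^sup>2 + (qIm3 I)\<^sup>2 = 1"
    by simp
qed

lemma slice_of_real [simp]: "slice I (of_real r) = of_real r"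
  by (simp add: slice_def)

lemma slice_add: "slice I (z + w) = slice I z + slice I w"
  by (simp add: slice_def algebra_simps)

lemma slice_diff: "slice I (z - w) = slice I z - slice I w"
  by (simp add: slice_def algebra_simps)

lemma slice_mult:
  assumes "I * I = - 1"
  shows "slice I (z * w) = slice I z * slice I w"
proof -
  have "Im z *\<^sub>R Im w *\<^sub>R (I * I) = - (Im z *\<^sub>R Im w *\<^sub>R 1)"
    unfolding assms by simp
  then show ?thesis
    by (simp add: slice_def quat_of_real_mult of_real_def algebra_simps)
qed

lemma slice_power:
  assumes "I * I = - 1"
  shows "slice I (z ^ n) = slice I z ^ n"
  using slice_of_real[of I 1] by (induction n) (simp_all add: slice_mult[OF assms])

lemma qRe_slice:
  assumes "I * I = - 1"
  shows "qRe (slice I z) = Re z"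
  using imaginary_unit_sel[OF assms] by (simp add: slice_def quat_of_real_mult)

lemma norm_slice:
  assumes "I * I = - 1"
  shows "norm (slice I z) = cmod z"
proof -
  have "(norm (slice I z))\<^sup>2 = (Re z)\<^sup>2 + (Im z)\<^sup>2 * ((qIm1 I)\<^sup>2 + (qIm2 I)\<^sup>2 + (qIm3 I)\<^sup>2)"
    unfolding norm_quat_squared using imaginary_unit_sel(1)[OF assms]
    by (simp add: slice_def quat_of_real_mult algebra_simps)
  also have "\<dots> = (cmod z)\<^sup>2"
    using imaginary_unit_sel(2)[OF assms] by (simp add: cmod_power2)
  finally show ?thesis
    by (simp add: power2_eq_iff_nonneg)
qed

text \<open>For nonreal \<open>x\<close>, \<open>I\<close> is the normalized imaginary part and
  \<open>Im z\<close> its length; a real \<open>x\<close> lies in every slice, and \<open>qi\<close>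
  is taken.\<close>

lemma quat_cases_slice:
  obtains I z where "I * I = - 1" "Im z \<ge> 0" "x = slice I z"
proof -
  define v where "v = sqrt ((qIm1 x)\<^sup>2 + (qIm2 x)\<^sup>2 + (qIm3 x)\<^sup>2)"
  have v2: "v * v = (qIm1 x)\<^sup>2 + (qIm2 x)\<^sup>2 + (qIm3 x)\<^sup>2" and "v \<ge> 0"
    by (simp_all add: v_def)
  show thesis
  proof (cases "v = 0")
    case True
    then have "qIm1 x = 0" "qIm2 x = 0" "qIm3 x = 0"
      using v2 by (auto simp: add_nonneg_eq_0_iff)
    then have "x = slice qi (of_real (qRe x))"
      by (simp add: quat_eq_iff)
    then show thesis
      using that[OF qi_square, of "of_real (qRe x)"] by simp
  next
    case False
    define I where "I = Quat 0 (qIm1 x / v) (qIm2 x / v) (qIm3 x / v)"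
    have "qIm1 x * qIm1 x / (v * v) + qIm2 x * qIm2 x / (v * v) + qIm3 x * qIm3 x / (v * v) = 1"
      unfolding add_divide_distrib[symmetric] using False v2
      by (subst v2) (simp add: power2_eq_square v2[symmetric, unfolded power2_eq_square])
    then have "I * I = - 1"
      by (simp add: I_def quat_eq_iff)
    moreover have "x = slice I (Complex (qRe x) v)"
      using False by (simp add: slice_def quat_eq_iff quat_of_real_mult I_def)
    ultimately show thesis
      using that[of I "Complex (qRe x) v"] \<open>v \<ge> 0\<close> by simp
  qed
qed

lemma continuous_slice [continuous_intros]:
  "continuous_on A f \<Longrightarrow> continuous_on A (\<lambda>x. slice I (f x))"
  unfolding slice_def by (intro continuous_intros)

text \<open>The representation formula: an affine function \<open>x \<mapsto> A + B x\<close> on an orbit is determined by its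
  values at the two points of the orbit in the slice of \<open>qi\<close>.\<close>

definition rep1 :: "quat \<Rightarrow> quat" where
  "rep1 I = scaleR (1/2) (1 - qi * I)"

definition rep2 :: "quat \<Rightarrow> quat" where
  "rep2 I = scaleR (1/2) (1 + qi * I)"

lemma rep_sum: "rep1 I + rep2 I = 1"
  by (simp add: rep1_def rep2_def quat_eq_iff flip: scaleR_add_right)

text \<open>Half the sum of \<open>z\<close> and \<open>cnj z\<close> is \<open>Re z\<close>; half
  the difference embeds as \<open>Im z * qi\<close>, which the factor \<open>- qi * I\<close> turns
  into \<open>Im z * I\<close>.\<close>

lemma slice_rep: "slice I z = slice qi z * rep1 I + slice qi (cnj z) * rep2 I"
  by (simp add: slice_def rep1_def rep2_def quat_eq_iff qi_def quat_of_real_mult field_simps)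

lemma affine_rep:
  "A + B * slice I z = (A + B * slice qi z) * rep1 I + (A + B * slice qi (cnj z)) * rep2 I"
proof -
  have "A + B * slice I z = A * (rep1 I + rep2 I) + B * (slice qi z * rep1 I + slice qi (cnj z) * rep2 I)"
    by (simp add: rep_sum flip: slice_rep)
  then show ?thesis
    by (simp only: algebra_simps)
qed


text \<open>\<open>rep1 I\<close> intertwines \<open>I\<close> with \<open>qi\<close>, and
  \<open>rep2 I\<close> intertwines \<open>I\<close> with \<open>- qi\<close>. This lets a right
  factor \<open>x\<close> pass through the representation formula.\<close>

lemma rep_mult_slice:
  assumes "I * I = - 1"
  shows "rep1 I * slice I z = slice qi z * rep1 I"
    and "rep2 I * slice I z = slice qi (cnj z) * rep2 I"
proof -
  have "rep1 I * I = qi * rep1 I" "rep2 I * I = - qi * rep2 I"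
    using assms qi_square by (simp_all add: rep1_def rep2_def algebra_simps) (simp_all flip: mult.assoc)
  then show "rep1 I * slice I z = slice qi z * rep1 I"
    "rep2 I * slice I z = slice qi (cnj z) * rep2 I"
    by (simp_all add: slice_def algebra_simps quat_of_real_mult quat_of_real_commute)
qed


section \<open>Orbits\<close>

definition qcnj :: "quat \<Rightarrow> quat" where
  "qcnj q = of_real (2 * qRe q) - q"

text \<open>\<open>orbit_poly\<close> with an explicit representative instead of a chosen one. For
  real \<open>q\<close> it is \<open>(x - q)^2\<close>, not \<open>x - q\<close>.\<close>

definition orb_poly :: "quat \<Rightarrow> quat \<Rightarrow> quat" where
  "orb_poly q x = x\<^sup>2 - of_real (2 * qRe q) * x + of_real ((norm q)\<^sup>2)"

lemma qcnj_mult: "qcnj q * q = of_real ((norm q)\<^sup>2)"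
  unfolding norm_quat_squared
  by (simp add: qcnj_def quat_eq_iff power2_eq_square algebra_simps)

text \<open>Both \<open>q + qcnj q\<close> and \<open>qcnj q * q\<close> are real. The formula
  measures how far \<open>x - q\<close> is from conjugating \<open>x\<close> into
  \<open>qcnj q\<close>.\<close>

lemma orb_poly_factor: "(x - q) * x - qcnj q * (x - q) = orb_poly q x"
proof -
  have "(x - q) * x - qcnj q * (x - q) = x\<^sup>2 - of_real (2 * qRe q) * x + qcnj q * q"
    by (simp add: qcnj_def algebra_simps power2_eq_square)
  then show ?thesis
    by (simp add: qcnj_mult orb_poly_def)
qed

lemma orb_poly_self: "orb_poly q q = 0"
  using norm_quat_squared[of q]
  by (simp add: orb_poly_def quat_of_real_mult quat_eq_iff power2_eq_square algebra_simps)

lemma orb_poly_cong: "qRe p = qRe q \<Longrightarrow> norm p = norm q \<Longrightarrow> orb_poly p = orb_poly q"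
  by (simp add: orb_poly_def fun_eq_iff)

lemma orb_poly_commute: "x * orb_poly q x = orb_poly q x * x"
proof -
  have "x * (x\<^sup>2 - of_real r * x + of_real s) = (x\<^sup>2 - of_real r * x + of_real s) * x" for r s
    by (simp add: of_real_def algebra_simps power2_eq_square)
  then show ?thesis
    by (simp only: orb_poly_def)
qed

lemma qRe_qcnj [simp]: "qRe (qcnj q) = qRe q"
  by (simp add: qcnj_def)

lemma norm_qcnj [simp]: "norm (qcnj q) = norm q"
  by (simp add: norm_quat_def qcnj_def)

lemma qcnj_qcnj [simp]: "qcnj (qcnj q) = q"
  by (simp add: qcnj_def)

lemma conj_act_eqI: "p \<noteq> 0 \<Longrightarrow> p * x = y * p \<Longrightarrow> conj_act p x = y"
  by (simp add: conj_act_def mult.assoc)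

lemma conj_act_mult: "p \<noteq> 0 \<Longrightarrow> conj_act p (x * y) = conj_act p x * conj_act p y"
  by (simp add: conj_act_def mult.assoc) (simp flip: mult.assoc)

lemma conj_act_commute: "p \<noteq> 0 \<Longrightarrow> conj_act p x * p = p * x"
  by (simp add: conj_act_def mult.assoc)

lemma orb_poly_conj_act:
  assumes "p \<noteq> 0"
  shows "orb_poly q (conj_act p x) = conj_act p (orb_poly q x)"
proof -
  have "conj_act p (orb_poly q x) =
      conj_act p (x\<^sup>2) - conj_act p (of_real (2 * qRe q) * x) + conj_act p (of_real ((norm q)\<^sup>2))"
    unfolding orb_poly_def conj_act_def by (simp only: algebra_simps)
  moreover have "conj_act p (of_real r) = of_real r" for r
    using assms by (intro conj_act_eqI) (simp_all add: quat_of_real_commute)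
  ultimately show ?thesis
    using assms by (simp only: conj_act_mult[OF assms] orb_poly_def power2_eq_square)
qed

text \<open>The quadratic vanishes at \<open>x\<close>, so \<open>orb_poly_factor\<close> becomes
  \<open>(x - q) * x = qcnj q * (x - q)\<close>.\<close>

lemma conj_act_same_sphere:
  assumes "qRe x = qRe q" "norm x = norm q" "x \<noteq> q"
  shows "conj_act (x - q) x = qcnj q"
  using orb_poly_factor[of x q] orb_poly_self[of x] orb_poly_cong[OF assms(1,2)] assms(3)
  by (intro conj_act_eqI) simp_all

section \<open>Orbits as spheres of fixed real part and norm\<close>

lemma conj_act_conj_act:
  "p \<noteq> 0 \<Longrightarrow> r \<noteq> 0 \<Longrightarrow> conj_act p (conj_act r x) = conj_act (p * r) x"
  by (simp add: conj_act_def nonzero_inverse_mult_distrib mult.assoc)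

text \<open>For the converse, conjugation by \<open>x - qcnj y\<close> carries \<open>x\<close> to
  \<open>y\<close> by \<open>conj_act_same_sphere\<close>, unless \<open>x = qcnj y\<close>; two
  distinct conjugate points are joined in two such moves.\<close>

lemma orbit_iff: "x \<in> orbit q \<longleftrightarrow> qRe x = qRe q \<and> norm x = norm q"
proof
  assume "x \<in> orbit q"
  then show "qRe x = qRe q \<and> norm x = norm q"
    by (auto simp: orbit_def qRe_conj_act norm_conj_act)
next
  assume *: "qRe x = qRe q \<and> norm x = norm q"
  have conj: "y \<in> orbit x" if "qRe x = qRe y" "norm x = norm y" "x \<noteq> qcnj y" for x y
  proof -
    have "conj_act (x - qcnj y) x = y"
      using conj_act_same_sphere[of x "qcnj y"] that by simp
    then show ?thesis
      unfolding orbit_def using that by (intro CollectI exI[of _ "x - qcnj y"]) simp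
  qed
  show "x \<in> orbit q"
  proof (cases "q = qcnj x")
    case False
    then show ?thesis
      using conj * by metis
  next
    case True
    obtain I z where I: "I * I = - 1" and q: "q = slice I z"
      by (metis quat_cases_slice)
    show ?thesis
    proof (cases "x = q")
      case True
      then show ?thesis
        by (simp add: self_in_orbit)
    next
      case False
      text \<open>A third point of the sphere links the conjugate points \<open>q\<close> and \<open>x\<close>.\<close>
      have "\<exists>J. J * J = - 1 \<and> J \<noteq> I \<and> J \<noteq> - I"
      proof (cases "I = qi \<or> I = - qi")
        case True
        then show ?thesis
          by (intro exI[of _ qj]) (auto simp: qi_def qj_def quat_eq_iff)
      next
        case False
        then show ?thesis
          using qi_square by (intro exI[of _ qi]) (metis minus_minus)
      qed
      then obtain J where J: "J * J = - 1" "J \<noteq> I" "J \<noteq> - I"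
        by auto
      define y where "y = slice J z"
      have z: "Im z \<noteq> 0"
        using \<open>x \<noteq> q\<close> * I True
        by (metis qcnj_def q qRe_slice slice_def add.right_neutral mult_zero_left of_real_0
            mult_2 of_real_add add_diff_cancel_right' qcnj_qcnj)
      have y: "qRe y = qRe q" "norm y = norm q"
        by (simp_all add: y_def q qRe_slice norm_slice I J)
      have "y \<noteq> q"
        using z J by (simp add: y_def q slice_def)
      moreover have "y \<noteq> qcnj q"
      proof
        assume "y = qcnj q"
        then have "slice J z + slice I z = of_real (2 * Re z)"
          by (simp only: y_def q qcnj_def qRe_slice[OF I] diff_add_cancel)
        moreover have "slice J z + slice I z = of_real (2 * Re z) + Im z *\<^sub>R (J + I)"
          by (simp add: slice_def quat_eq_iff quat_of_real_mult algebra_simps)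
        ultimately have "J + I = 0"
          using z by simp
        then show False
          using J(3) by (simp add: eq_neg_iff_add_eq_0)
      qed
      \<comment> \<open>\<open>conj\<close> excludes only pairs of conjugate points, and
        \<open>y\<close> is conjugate to neither \<open>q\<close> nor
        \<open>x = qcnj q\<close>.\<close>
      ultimately have "y \<in> orbit q" "x \<in> orbit y"
        using conj[of q y] conj[of y x] y * True by (metis qcnj_qcnj)+
      then obtain p r where "p \<noteq> 0" "r \<noteq> 0" "x = conj_act p (conj_act r q)"
        by (auto simp: orbit_def)
      then show ?thesis
        by (force simp: conj_act_conj_act orbit_def)
    qed
  qed
qed

lemma orbit_subset_region: "region U \<Longrightarrow> q \<in> U \<Longrightarrow> orbit q \<subseteq> U"
  by (auto simp: orbit_def region_def)

lemma region_slice_iff: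
  assumes "region U" "I * I = - 1" "J * J = - 1"
  shows "slice I z \<in> U \<longleftrightarrow> slice J z \<in> U"
proof -
  have "slice I z \<in> orbit (slice J z)" "slice J z \<in> orbit (slice I z)"
    using assms by (simp_all add: orbit_iff qRe_slice norm_slice)
  then show ?thesis
    using orbit_subset_region[OF assms(1)] by blast
qed

lemma slice_cnj_in_region:
  assumes "region U" "slice qi z \<in> U"
  shows "slice qi (cnj z) \<in> U"
proof -
  have "slice qi (cnj z) \<in> orbit (slice qi z)"
    by (simp add: orbit_iff qRe_slice norm_slice qi_square)
  then show ?thesis
    using orbit_subset_region[OF assms] by blast
qed

text \<open>A hyperplane section of a sphere. Compactness later supplies one radius that works along
  the whole orbit.\<close>

lemma compact_orbit: "compact (orbit q)"
proof -
  have eq: "orbit q = {x. inner x 1 = qRe q} \<inter> sphere 0 (norm q)"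
    by (auto simp: orbit_iff inner_quat_def)
  have "closed {x::quat. inner x 1 = qRe q}"
    by (intro closed_Collect_eq continuous_intros)
  then show ?thesis
    unfolding eq by (intro closed_Int_compact) auto
qed

section \<open>The quadratic on slices and its control of the distance to the orbit\<close>

lemma orb_poly_slice:
  assumes "I * I = - 1" "J * J = - 1"
  shows "orb_poly (slice J w) (slice I z) = slice I ((z - w) * (z - cnj w))"
proof -
  have "(z - w) * (z - cnj w) = z\<^sup>2 - (w + cnj w) * z + w * cnj w"
    by (simp add: algebra_simps power2_eq_square)
  then have "(z - w) * (z - cnj w) = z\<^sup>2 - of_real (2 * Re w) * z + of_real ((cmod w)\<^sup>2)"
    by (simp only: complex_add_cnj complex_norm_square)
  then show ?thesis
    using assms
    by (simp only: orb_poly_def qRe_slice norm_slice slice_add slice_diff slice_mult slice_power slice_of_real)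
qed

text \<open>With \<open>z\<close> and \<open>w\<close> in the closed upper half-plane,
  \<open>w\<close> is at least as near to \<open>z\<close> as \<open>cnj w\<close>, so
  \<open>(cmod (z - w))^2\<close> is at most the modulus of \<open>(z - w) * (z - cnj w)\<close>.
  The point \<open>y\<close> is \<open>w\<close> placed in the slice of \<open>x\<close>.\<close>

lemma orb_poly_dist_orbit:
  obtains y where "y \<in> orbit q" "(dist x y)\<^sup>2 \<le> norm (orb_poly q x)"
proof -
  obtain I z where I: "I * I = - 1" "Im z \<ge> 0" and x: "x = slice I z"
    by (metis quat_cases_slice)
  obtain J w where J: "J * J = - 1" "Im w \<ge> 0" and q: "q = slice J w"
    by (metis quat_cases_slice)
  have "\<bar>Im z - Im w\<bar> \<le> \<bar>Im z + Im w\<bar>"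
    using I J by linarith
  then have "(Im z - Im w)\<^sup>2 \<le> (Im z + Im w)\<^sup>2"
    by (rule abs_le_square_iff[THEN iffD1])
  then have "(cmod (z - w))\<^sup>2 \<le> (cmod (z - cnj w))\<^sup>2"
    by (simp add: cmod_power2)
  then have "cmod (z - w) \<le> cmod (z - cnj w)"
    by (simp add: abs_le_square_iff[symmetric])
  then have "cmod (z - w) * cmod (z - w) \<le> cmod (z - w) * cmod (z - cnj w)"
    by (intro mult_left_mono) auto
  also have "\<dots> = norm (orb_poly q x)"
    by (simp add: x q orb_poly_slice I J norm_slice norm_mult)
  also have "cmod (z - w) = dist x (slice I w)"
    by (simp add: x dist_norm norm_slice I flip: slice_diff)
  finally show thesis
    by (intro that[of "slice I w"]) (simp_all add: orbit_iff q qRe_slice norm_slice I J power2_eq_square)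
qed

lemma orb_poly_eq_0_iff: "orb_poly q x = 0 \<longleftrightarrow> x \<in> orbit q"
proof
  assume "orb_poly q x = 0"
  moreover obtain y where "y \<in> orbit q" "(dist x y)\<^sup>2 \<le> norm (orb_poly q x)"
    by (rule orb_poly_dist_orbit)
  ultimately show "x \<in> orbit q"
    by simp
next
  assume "x \<in> orbit q"
  then show "orb_poly q x = 0"
    using orb_poly_self[of x] orb_poly_cong[of x q] by (simp add: orbit_iff)
qed

lemma continuous_orb_poly: "continuous_on A (orb_poly q)"
  unfolding orb_poly_def by (intro continuous_intros)

lemma orbit_poly_eq: "q \<notin> \<real> \<Longrightarrow> orbit_poly (orbit q) = orb_poly q"
  using orbit_poly_nontrivial[of "orbit q" q] trivial_orbit_iff self_in_orbit
  by (auto simp: orb_poly_def)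

lemma orbit_of_real: "q \<in> \<real> \<Longrightarrow> orbit q = {q}"
  using trivial_orbit_iff[of q] self_in_orbit[of q] by (auto simp: trivial_orbit_def)


section \<open>From spherical series to skew differentiability\<close>

text \<open>The series minus \<open>a 0\<close> is a bounded factor times \<open>s\<close>. The
  limit is along \<open>nhds 0\<close>, which includes 0, because it gets composed with expressions
  that take the value 0 on a whole orbit.\<close>

lemma powser_tendsto_coeff_0:
  fixes a :: "nat \<Rightarrow> 'a::{real_normed_div_algebra,banach}"
  assumes "summable (\<lambda>n. a n * s0 ^ n)" "s0 \<noteq> 0"
  shows "((\<lambda>s. \<Sum>n. a n * s ^ n) \<longlongrightarrow> a 0) (nhds 0)"
proof -
  \<comment> \<open>Halving moves strictly inside the known point of convergence, which makes the
    series absolutely convergent.\<close>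
  define s1 where "s1 = scaleR (1/2) s0"
  have s1: "norm s1 < norm s0" "norm s1 > 0"
    using assms(2) by (simp_all add: s1_def)
  have b: "summable (\<lambda>n. norm (a (Suc n) * s1 ^ n))"
    using powser_insidea[OF powser_split_head(3)[OF assms(1)] s1(1)] .
  define K where "K = (\<Sum>n. norm (a (Suc n) * s1 ^ n))"
  have bound: "norm ((\<Sum>n. a n * s ^ n) - a 0) \<le> norm s * K" if "norm s < norm s1" for s
  proof -
    have le: "norm (a (Suc n) * s ^ n) \<le> norm (a (Suc n) * s1 ^ n)" for n
      using that by (simp add: norm_mult norm_power mult_left_mono power_mono)
    have sm: "summable (\<lambda>n. norm (a (Suc n) * s ^ n))"
      by (rule summable_comparison_test'[OF b]) (use le in simp)
    have "norm (\<Sum>n. a (Suc n) * s ^ n) \<le> K"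
      unfolding K_def by (rule order_trans[OF summable_norm[OF sm] suminf_le[OF le sm b]])
    moreover have "(\<Sum>n. a n * s ^ n) - a 0 = (\<Sum>n. a (Suc n) * s ^ n) * s"
      using powser_split_head(2)[OF powser_inside[OF assms(1)], of s] that s1 by simp
    ultimately show ?thesis
      by (simp add: norm_mult mult.commute[of "norm s"] mult_right_mono)
  qed
  have "((\<lambda>s::'a. norm s * K) \<longlongrightarrow> norm (0::'a) * K) (nhds 0)"
    by (intro tendsto_intros filterlim_ident)
  then have "((\<lambda>s. (\<Sum>n. a n * s ^ n) - a 0) \<longlongrightarrow> 0) (nhds 0)"
  proof (rule Lim_null_comparison[rotated, OF tendsto_eq_rhs])
    have "\<forall>\<^sub>F s in nhds 0. s \<in> ball 0 (norm s1)"
      using s1 by (intro eventually_nhds_in_open) auto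
    then show "\<forall>\<^sub>F s in nhds 0. norm ((\<Sum>n. a n * s ^ n) - a 0) \<le> norm s * K"
      by eventually_elim (rule bound, simp)
  qed simp
  then show ?thesis
    by (rule LIM_zero_cancel)
qed

section \<open>Skew quotients at real points\<close>

lemma skew_prod_ident: "(S \<diamondop> (\<lambda>y. y)) x = S x * x"
  by (simp add: skew_prod_def conj_act_def mult.assoc)

lemma skew_differentiableI:
  assumes "\<And>p. p \<in> orbit q \<Longrightarrow> isCont D p" "\<And>x. F x = F q + (D \<diamondop> (\<lambda>y. y - q)) x"
  shows "skew_differentiable F U q"
  unfolding skew_differentiable_def using assms continuous_at_imp_continuous_at_within by blast

text \<open>For real \<open>q\<close>, \<open>x - q\<close> commutes with \<open>x\<close>, so the
  skew quotient is the ordinary right quotient; its series is that of \<open>F\<close> shifted by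
  one index.\<close>

lemma skew_differentiable_real_center:
  assumes "open V" "q \<in> V" "V \<subseteq> U" "q \<in> \<real>"
    and conv: "\<And>x. x \<in> V \<Longrightarrow> summable (\<lambda>n. a n * (x - q) ^ n)"
    and F: "\<And>x. x \<in> V \<Longrightarrow> F x = (\<Sum>n. a n * (x - q) ^ n)"
  shows "skew_differentiable F U q"
proof -
  obtain e where "e > 0" and e: "ball q e \<subseteq> V"
    using assms(1,2) open_contains_ball by blast
  \<comment> \<open>A nonzero displacement inside \<open>V\<close>, giving the nonzero point of
    convergence for \<open>powser_tendsto_coeff_0\<close>.\<close>
  define s0 :: quat where "s0 = of_real (e / 2)"
  have s0: "q + s0 \<in> V" "s0 \<noteq> 0"
    using \<open>e > 0\<close> e by (auto simp: s0_def dist_norm simp del: of_real_divide)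
  have Fq: "F q = a 0"
    using F[OF \<open>q \<in> V\<close>] by simp
  define D where "D = (\<lambda>x. if x = q then a 1 else (F x - F q) * inverse (x - q))"
  have D: "D x = (\<Sum>n. a (Suc n) * (x - q) ^ n)" if "x \<in> V" for x
  proof (cases "x = q")
    case False
    have "F x - F q = (\<Sum>n. a (Suc n) * (x - q) ^ n) * (x - q)"
      using powser_split_head(2)[OF conv[OF that]] by (simp add: Fq F that)
    then show ?thesis
      using False by (simp add: D_def mult.assoc)
  qed (simp add: D_def)
  have cont: "isCont D q"
  proof -
    have "((\<lambda>s. \<Sum>n. a (Suc n) * s ^ n) \<longlongrightarrow> a (Suc 0)) (nhds 0)"
      using powser_split_head(3)[OF conv[OF s0(1)]] s0(2)
      by (intro powser_tendsto_coeff_0[of "\<lambda>n. a (Suc n)" s0]) simp_all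
    moreover have "((\<lambda>x. x - q) \<longlongrightarrow> 0) (at q)"
      by (rule LIM_zero[OF tendsto_ident_at])
    ultimately have "((\<lambda>x. \<Sum>n. a (Suc n) * (x - q) ^ n) \<longlongrightarrow> D q) (at q)"
      by (auto simp: D_def intro: filterlim_compose)
    moreover have "\<forall>\<^sub>F x in at q. (\<Sum>n. a (Suc n) * (x - q) ^ n) = D x"
      using eventually_at_in_open'[OF assms(1,2)] by eventually_elim (simp add: D)
    ultimately show ?thesis
      unfolding isCont_def by (rule Lim_transform_eventually)
  qed
  have eq: "F x = F q + (D \<diamondop> (\<lambda>y. y - q)) x" for x
  proof (cases "x = q")
    case False
    obtain r where r: "q = of_real r"
      using assms(4) by (auto elim: Reals_cases)
    have "conj_act (x - q) x = x"
      using False by (intro conj_act_eqI) (simp_all add: algebra_simps r quat_of_real_commute)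
    then show ?thesis
      using False by (simp add: skew_prod_def D_def mult.assoc)
  qed (simp add: skew_prod_def)
  show ?thesis
    by (rule skew_differentiableI[OF _ eq]) (use cont orbit_of_real[OF assms(4)] in simp)
qed

text \<open>From \<open>y * (x - q) = (x - q) * x\<close>, \<open>orb_poly_factor\<close> gives the
  product formula, whose value is nonzero off the orbit and commutes with \<open>x\<close>.
  Cancelling \<open>x - q\<close> then shows that \<open>y - qcnj q\<close> conjugates
  \<open>y\<close> back to \<open>x\<close>.\<close>

lemma conj_act_shift_inverse:
  assumes "x \<notin> orbit q"
  defines "y \<equiv> conj_act (x - q) x"
  shows "y - qcnj q \<noteq> 0" "conj_act (y - qcnj q) y = x" "(y - qcnj q) * (x - q) = orb_poly q x"
proof -
  have nz: "x - q \<noteq> 0"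
    using assms(1) self_in_orbit[of q] by auto
  have "y * (x - q) = (x - q) * x"
    unfolding y_def using nz by (rule conj_act_commute)
  then show eq: "(y - qcnj q) * (x - q) = orb_poly q x"
    by (simp add: algebra_simps flip: orb_poly_factor)
  have P: "orb_poly q x \<noteq> 0"
    using assms(1) by (simp add: orb_poly_eq_0_iff)
  then show y: "y - qcnj q \<noteq> 0"
    using eq by auto
  have "(y - qcnj q) * y * (x - q) = (y - qcnj q) * (x - q) * x"
    by (simp add: mult.assoc \<open>y * (x - q) = (x - q) * x\<close>)
  also have "\<dots> = orb_poly q x * x"
    by (simp add: eq)
  also have "\<dots> = x * orb_poly q x"
    by (rule orb_poly_commute[symmetric])
  also have "\<dots> = x * (y - qcnj q) * (x - q)"
    by (simp add: mult.assoc eq)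
  finally have "(y - qcnj q) * y = x * (y - qcnj q)"
    using nz by simp
  then show "conj_act (y - qcnj q) y = x"
    using y by (intro conj_act_eqI)
qed

lemma skew_differentiable_sphere_center:
  assumes "open V" "orbit q \<subseteq> V" "V \<subseteq> U"
    and conv_a: "\<And>x. x \<in> V \<Longrightarrow> summable (\<lambda>n. a n * orb_poly q x ^ n)"
    and conv_b: "\<And>x. x \<in> V \<Longrightarrow> summable (\<lambda>n. b n * orb_poly q x ^ n)"
    and F: "\<And>x. x \<in> V \<Longrightarrow>
      F x = (\<Sum>n. a n * orb_poly q x ^ n) + (\<Sum>n. b n * orb_poly q x ^ n) * x"
  shows "skew_differentiable F U q"
proof -
  define c where "c = qcnj q"
  define hA where "hA = (\<lambda>s. \<Sum>n. a (Suc n) * s ^ n)"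
  define hB where "hB = (\<lambda>s. \<Sum>n. b (Suc n) * s ^ n)"
  obtain e where "e > 0" and e: "(\<Union>x\<in>orbit q. ball x e) \<subseteq> V"
    using compact_subset_open_imp_ball_epsilon_subset[OF compact_orbit assms(1,2)] .
  \<comment> \<open>A sublevel set of the norm of the quadratic is stable under the substitution
    below, which can move a point far along the sphere.\<close>
  have V: "x \<in> V" if "norm (orb_poly q x) < e\<^sup>2" for x
  proof -
    obtain y where y: "y \<in> orbit q" "(dist x y)\<^sup>2 \<le> norm (orb_poly q x)"
      by (rule orb_poly_dist_orbit)
    then have "(dist x y)\<^sup>2 < e\<^sup>2"
      using that by linarith
    then have "dist y x < e"
      using \<open>e > 0\<close> by (metis dist_commute less_imp_le power2_less_imp_less)
    then show ?thesis
      using e y(1) by (meson UN_I mem_ball subsetD)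
  qed
  \<comment> \<open>Changing the real part leaves the orbit, so both series converge at a nonzero
    argument.\<close>
  define x0 where "x0 = q + of_real (e / 2)"
  have "x0 \<in> ball q e"
    using \<open>e > 0\<close> by (simp add: x0_def dist_norm del: of_real_divide)
  then have x0: "x0 \<in> V"
    using e self_in_orbit[of q] by blast
  have "x0 \<notin> orbit q"
    using \<open>e > 0\<close> by (simp add: orbit_iff x0_def del: of_real_divide)
  then have s0: "orb_poly q x0 \<noteq> 0"
    by (simp add: orb_poly_eq_0_iff)
  have hA: "(hA \<longlongrightarrow> a 1) (nhds 0)" and hB: "(hB \<longlongrightarrow> b 1) (nhds 0)"
    unfolding hA_def hB_def
    using powser_tendsto_coeff_0[OF powser_split_head(3)[OF conv_a[OF x0]] s0]
      powser_tendsto_coeff_0[OF powser_split_head(3)[OF conv_b[OF x0]] s0] by simp_all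
  have Fq: "F q = a 0 + b 0 * q"
    using F[of q] assms(2) self_in_orbit[of q] by (auto simp: orb_poly_self)
  have F_diff: "F x - F q = b 0 * (x - q) + (hA (orb_poly q x) + hB (orb_poly q x) * x) * orb_poly q x"
    if "x \<in> V" for x
  proof -
    have "x * orb_poly q x = orb_poly q x * x"
      by (rule orb_poly_commute)
    then have "hB (orb_poly q x) * x * orb_poly q x = hB (orb_poly q x) * orb_poly q x * x"
      by (simp add: mult.assoc)
    then show ?thesis
      using powser_split_head(1)[OF conv_a[OF that]] powser_split_head(1)[OF conv_b[OF that]]
      by (simp add: F[OF that] Fq hA_def hB_def algebra_simps orb_poly_commute)
  qed
  \<comment> \<open>The inverse substitution. At \<open>y = c\<close> the conjugation degenerates;
    any value on the orbit keeps the quadratic at 0 there.\<close>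
  define X where "X = (\<lambda>y. if y = c then q else conj_act (y - c) y)"
  \<comment> \<open>On the orbit these are the limiting values; elsewhere the quotient itself, so
    the defining equation also holds where no series is available.\<close>
  define D where "D = (\<lambda>y. if y \<in> orbit q then b 0 + a 1 * (y - c) + b 1 * (y - c) * y
    else (F (X y) - F q) * inverse (X y - q))"
  have c: "c \<in> orbit q"
    by (simp add: c_def orbit_iff)
  have norm_X: "norm (orb_poly q (X y)) = norm (orb_poly q y)" for y
    using c by (auto simp: X_def orb_poly_conj_act norm_conj_act orb_poly_self orb_poly_eq_0_iff[of q c])
  have D: "D y = b 0 + hA (orb_poly q (X y)) * (y - c) + hB (orb_poly q (X y)) * (y - c) * y"
    if "norm (orb_poly q y) < e\<^sup>2" for y
  proof (cases "y \<in> orbit q")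
    case True
    then have "orb_poly q (X y) = 0"
      using norm_X[of y] orb_poly_eq_0_iff[of q y] by simp
    then show ?thesis
      using True by (simp add: D_def hA_def hB_def)
  next
    case False
    define x where "x = X y"
    have "y \<noteq> c"
      using False c by auto
    then have x: "x = conj_act (y - c) y"
      by (simp add: x_def X_def)
    have "x \<in> V"
      using that norm_X[of y] by (intro V) (simp add: x_def)
    have "orb_poly q x \<noteq> 0"
      using norm_X[of y] False by (simp add: x_def flip: orb_poly_eq_0_iff) (metis norm_eq_zero)
    then have "x \<notin> orbit q"
      by (simp add: orb_poly_eq_0_iff)
    then have "x - q \<noteq> 0"
      using self_in_orbit[of q] by auto
    \<comment> \<open>This lets \<open>conj_act_shift_inverse\<close> be applied with
      \<open>q\<close> and \<open>c\<close> exchanged, starting from \<open>y\<close>.\<close>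
    have "orb_poly q = orb_poly c"
      by (rule orb_poly_cong) (simp_all add: c_def)
    moreover have "y \<notin> orbit c"
      using False by (simp add: orbit_iff c_def)
    ultimately have "(x - q) * (y - c) = orb_poly q y"
      using conj_act_shift_inverse(3)[of y c] by (simp add: x c_def)
    have "conj_act (x - q) x = y"
      using conj_act_shift_inverse(2)[OF \<open>y \<notin> orbit c\<close>] by (simp add: x c_def)
    then have P: "(y - c) * (x - q) = orb_poly q x"
      using conj_act_shift_inverse(3)[OF \<open>x \<notin> orbit q\<close>] by (simp add: c_def)
    \<comment> \<open>Replaces \<open>x\<close> by \<open>y\<close> in the \<open>hB\<close> term,
      leaving only the quadratic to depend on \<open>X y\<close>.\<close>
    have xy: "x * (y - c) = (y - c) * y"
      unfolding x using \<open>y \<noteq> c\<close> by (intro conj_act_commute) simp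
    have "D y = (F x - F q) * inverse (x - q)"
      using False by (simp add: D_def x_def)
    also have "\<dots> = b 0 + (hA (orb_poly q x) + hB (orb_poly q x) * x) * (orb_poly q x * inverse (x - q))"
      using \<open>x - q \<noteq> 0\<close> by (simp add: F_diff \<open>x \<in> V\<close> distrib_right mult.assoc)
    also have "orb_poly q x * inverse (x - q) = y - c"
      using \<open>x - q \<noteq> 0\<close> by (simp add: mult.assoc flip: P)
    finally show ?thesis
      by (simp add: distrib_right mult.assoc xy[unfolded x_def] x_def)
  qed
  have "isCont D p" if p: "p \<in> orbit q" for p
  proof -
    have P0: "orb_poly q p = 0"
      using p by (simp add: orb_poly_eq_0_iff)
    have "isCont (orb_poly q) p"
      using continuous_orb_poly[of UNIV q] by (simp add: continuous_on_eq_continuous_at)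
    then have P: "(orb_poly q \<longlongrightarrow> 0) (at p)"
      using P0 by (simp add: isCont_def)
    \<comment> \<open>Only norms are compared: no continuity of \<open>X\<close> at \<open>c\<close>
      enters.\<close>
    then have "((\<lambda>y. orb_poly q (X y)) \<longlongrightarrow> 0) (at p)"
      by (subst tendsto_norm_zero_iff[symmetric]) (simp add: norm_X tendsto_norm_zero)
    then have "((\<lambda>y. b 0 + hA (orb_poly q (X y)) * (y - c) + hB (orb_poly q (X y)) * (y - c) * y)
        \<longlongrightarrow> b 0 + a 1 * (p - c) + b 1 * (p - c) * p) (at p)"
      by (intro tendsto_intros filterlim_compose[OF hA] filterlim_compose[OF hB])
    moreover have "D p = b 0 + a 1 * (p - c) + b 1 * (p - c) * p"
      using p by (simp add: D_def)
    moreover have "\<forall>\<^sub>F y in at p. norm (orb_poly q y) < e\<^sup>2"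
      using order_tendstoD(2)[OF tendsto_norm_zero[OF P]] \<open>e > 0\<close> by simp
    then have "\<forall>\<^sub>F y in at p.
        b 0 + hA (orb_poly q (X y)) * (y - c) + hB (orb_poly q (X y)) * (y - c) * y = D y"
      by eventually_elim (simp add: D)
    ultimately show ?thesis
      unfolding isCont_def by (auto intro: Lim_transform_eventually)
  qed
  moreover have "F x = F q + (D \<diamondop> (\<lambda>y. y - q)) x" for x
  proof (cases "x = q")
    case neq: False
    define y where "y = conj_act (x - q) x"
    have "F x - F q = D y * (x - q)"
    proof (cases "x \<in> orbit q")
      case True
      \<comment> \<open>On the orbit \<open>D\<close> is evaluated only at \<open>c\<close>, where
        both terms with the factor \<open>y - c\<close> vanish and \<open>b 0\<close>
        remains.\<close>
      then have "y = c"
        using neq by (simp add: y_def c_def orbit_iff conj_act_same_sphere)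
      moreover have "F x - F q = b 0 * (x - q)"
        using F_diff[of x] True assms(2) orb_poly_eq_0_iff[of q x] by auto
      ultimately show ?thesis
        using c by (simp add: D_def)
    next
      case False
      have "y \<notin> orbit q"
        using False neq by (simp add: y_def orbit_iff qRe_conj_act norm_conj_act)
      moreover have "X y = x"
        using conj_act_shift_inverse[OF False] by (simp add: X_def y_def c_def)
      ultimately show ?thesis
        using neq by (simp add: D_def mult.assoc)
    qed
    then show ?thesis
      using neq by (simp add: skew_prod_def y_def) (metis add.commute diff_add_cancel)
  qed (simp add: skew_prod_def)
  ultimately show ?thesis
    by (rule skew_differentiableI)
qed

lemma symmetrically_analytic_imp_skew_regular:
  assumes "region U" "symmetrically_analytic_on U F"
  shows "skew_regular_on U F"
  unfolding skew_regular_on_def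
proof
  fix q assume "q \<in> U"
  then have S: "orbit q \<in> range orbit" "orbit q \<subseteq> U"
    using orbit_subset_region[OF assms(1)] by auto
  note analytic = assms(2)[unfolded symmetrically_analytic_on_def, THEN bspec, OF S(1), THEN mp, OF S(2)]
  show "skew_differentiable F U q"
  proof (cases "q \<in> \<real>")
    case True
    with analytic[THEN conjunct1, THEN mp] obtain a V where "open V" "orbit q \<subseteq> V" "V \<subseteq> U"
      "spherical_convergent_on (orbit q) a V" "\<forall>x\<in>V. F x = spherical_series (orbit q) a x"
      unfolding trivial_orbit_iff by meson
    then show ?thesis
      using True
      by (intro skew_differentiable_real_center[of V q U a])
        (auto simp: orbit_of_real orbit_poly_trivial spherical_convergent_on_def spherical_series_def)
  next
    case False
    then have "\<not> trivial_orbit (orbit q)"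
      by (simp add: trivial_orbit_iff)
    from analytic[THEN conjunct2, THEN mp, OF this] obtain a b V where "open V" "orbit q \<subseteq> V" "V \<subseteq> U"
      "spherical_convergent_on (orbit q) a V" "spherical_convergent_on (orbit q) b V"
      "\<forall>x\<in>V. F x = spherical_series (orbit q) a x + (spherical_series (orbit q) b \<diamondop> (\<lambda>y. y)) x"
      by meson
    then show ?thesis
      using False
      by (intro skew_differentiable_sphere_center[of V q U a b])
        (auto simp: orbit_poly_eq spherical_convergent_on_def spherical_series_def skew_prod_ident)
  qed
qed


section \<open>From skew regularity to spherical series\<close>

definition qfst :: "quat \<Rightarrow> complex" where
  "qfst x = Complex (qRe x) (qIm1 x)"

text \<open>The sign comes from \<open>qj * qi = - k\<close>.\<close>

definition qsnd :: "quat \<Rightarrow> complex" where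
  "qsnd x = Complex (qIm2 x) (- qIm3 x)"

lemma quat_split: "x = slice qi (qfst x) + qj * slice qi (qsnd x)"
  by (simp add: qfst_def qsnd_def slice_def qi_def qj_def quat_eq_iff quat_of_real_mult)

text \<open>The coordinates are complex linear for right multiplication, the side on which
  \<open>x - q\<close> stands in the skew quotient.\<close>

lemma qfst_mult_slice: "qfst (x * slice qi z) = qfst x * z"
  and qsnd_mult_slice: "qsnd (x * slice qi z) = qsnd x * z"
  by (simp_all add: qfst_def qsnd_def slice_def qi_def complex_eq_iff quat_of_real_mult algebra_simps)

lemma linear_qfst: "linear qfst" and linear_qsnd: "linear qsnd"
  by (auto intro!: linearI simp: qfst_def qsnd_def complex_eq_iff)

lemma linear_slice: "linear (slice I)"
  by (auto intro!: linearI simp: slice_add) (simp add: slice_def quat_of_real_mult algebra_simps)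

text \<open>Viewing \<open>quat\<close> as the right complex vector space \<open>\<complex> \<oplus> j \<complex>\<close>.\<close>

definition slice_holomorphic_on :: "(complex \<Rightarrow> quat) \<Rightarrow> complex set \<Rightarrow> bool" where
  "slice_holomorphic_on f A \<longleftrightarrow>
    (\<lambda>z. qfst (f z)) holomorphic_on A \<and> (\<lambda>z. qsnd (f z)) holomorphic_on A"

lemma slice_holomorphic_on_diff:
  "slice_holomorphic_on f A \<Longrightarrow> slice_holomorphic_on g A \<Longrightarrow> slice_holomorphic_on (\<lambda>z. f z - g z) A"
  unfolding slice_holomorphic_on_def
  by (simp add: linear_diff linear_qfst linear_qsnd holomorphic_on_diff)

lemma slice_holomorphic_on_mult:
  "slice_holomorphic_on f A \<Longrightarrow> g holomorphic_on A \<Longrightarrow>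
    slice_holomorphic_on (\<lambda>z. f z * slice qi (g z)) A"
  unfolding slice_holomorphic_on_def
  by (simp add: qfst_mult_slice qsnd_mult_slice holomorphic_on_mult)

lemma slice_holomorphic_on_compose:
  "slice_holomorphic_on f B \<Longrightarrow> g holomorphic_on A \<Longrightarrow> g ` A \<subseteq> B \<Longrightarrow>
    slice_holomorphic_on (\<lambda>z. f (g z)) A"
  unfolding slice_holomorphic_on_def
  using holomorphic_on_compose_gen[of g A "\<lambda>z. qfst (f z)" B]
    holomorphic_on_compose_gen[of g A "\<lambda>z. qsnd (f z)" B] by (simp add: o_def)

text \<open>The Taylor coefficients of the two coordinates combine into quaternions
  \<open>a n\<close>, which serve every slice at once by \<open>slice_rep\<close>.\<close>

lemma slice_holomorphic_power_series:
  assumes "slice_holomorphic_on f (ball 0 e)"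
  obtains a where "\<And>I s. norm s < e \<Longrightarrow>
    (\<lambda>n. a n * slice I (s ^ n)) sums (f s * rep1 I + f (cnj s) * rep2 I)"
proof -
  define c where "c = (\<lambda>n. (deriv ^^ n) (\<lambda>z. qfst (f z)) 0 / fact n)"
  define d where "d = (\<lambda>n. (deriv ^^ n) (\<lambda>z. qsnd (f z)) 0 / fact n)"
  define a where "a = (\<lambda>n. slice qi (c n) + qj * slice qi (d n))"
  have *: "(\<lambda>n. a n * slice qi (s ^ n)) sums f s" if "norm s < e" for s
  proof -
    have bl: "bounded_linear (slice qi)"
      using linear_slice linear_conv_bounded_linear by blast
    have "(\<lambda>n. c n * s ^ n) sums qfst (f s)" "(\<lambda>n. d n * s ^ n) sums qsnd (f s)"
      unfolding c_def d_def
      using assms that holomorphic_power_series[of "\<lambda>z. qfst (f z)" 0 e s]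
        holomorphic_power_series[of "\<lambda>z. qsnd (f z)" 0 e s]
      by (simp_all add: slice_holomorphic_on_def)
    then have "(\<lambda>n. slice qi (c n * s ^ n) + qj * slice qi (d n * s ^ n)) sums
        (slice qi (qfst (f s)) + qj * slice qi (qsnd (f s)))"
      by (intro sums_add sums_mult bounded_linear.sums[OF bl])
    then show ?thesis
      by (simp add: a_def slice_mult[OF qi_square] algebra_simps flip: quat_split)
  qed
  show thesis
  proof (rule that[of a])
    fix I s assume s: "norm (s::complex) < e"
    have "(\<lambda>n. a n * slice qi (s ^ n) * rep1 I + a n * slice qi (cnj s ^ n) * rep2 I) sums
        (f s * rep1 I + f (cnj s) * rep2 I)"
      using s by (intro sums_add sums_mult2 *) simp_all
    then show "(\<lambda>n. a n * slice I (s ^ n)) sums (f s * rep1 I + f (cnj s) * rep2 I)"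
      by (subst slice_rep) (simp add: algebra_simps)
  qed
qed

text \<open>Points of one slice commute, so \<open>D\<close> restricted to the slice is the
  difference quotient, and its continuity at the center yields the complex derivative.\<close>

lemma skew_regular_slice_holomorphic:
  assumes "region U" "skew_regular_on U F"
  shows "slice_holomorphic_on (\<lambda>z. F (slice qi z)) {z. slice qi z \<in> U}" (is "slice_holomorphic_on ?f ?Z")
    and "open {z. slice qi z \<in> U}"
proof -
  have cont: "continuous_on UNIV (slice qi)"
    by (intro continuous_intros)
  have "open U"
    using assms(1) by (simp add: region_def)
  then have "open (slice qi -` U)"
    using cont by (intro open_vimage)
  then show "open ?Z"
    by (simp add: vimage_def)
  \<comment> \<open>\<open>L\<close> stands for either complex coordinate.\<close>
  have *: "(\<lambda>z. L (?f z)) holomorphic_on ?Z"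
    if L: "linear L" "\<And>x z. L (x * slice qi z) = L x * z" for L :: "quat \<Rightarrow> complex"
    unfolding holomorphic_on_open[OF \<open>open ?Z\<close>]
  proof
    fix w assume w: "w \<in> ?Z"
    then have "skew_differentiable F U (slice qi w)"
      using assms(2) by (simp add: skew_regular_on_def)
    then obtain D where D: "continuous (at (slice qi w) within U) D"
      and F: "\<And>x. x \<in> U \<Longrightarrow> F x = F (slice qi w) + (D \<diamondop> (\<lambda>y. y - slice qi w)) x"
      unfolding skew_differentiable_def using self_in_orbit by blast
    have "isCont D (slice qi w)"
      using D w by (simp add: at_within_open[OF _ \<open>open U\<close>])
    moreover have "isCont (slice qi) w"
      using cont by (simp add: continuous_on_eq_continuous_at)
    moreover have "isCont L (D (slice qi w))"
      using L(1) by (simp add: linear_continuous_at linear_conv_bounded_linear[symmetric])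
    ultimately have "isCont (\<lambda>z. L (D (slice qi z))) w"
      using isCont_o2[of w "slice qi" D] isCont_o2[of w "\<lambda>z. D (slice qi z)" L] by blast
    then have lim: "((\<lambda>z. L (D (slice qi z))) \<longlongrightarrow> L (D (slice qi w))) (at w)"
      by (simp add: isCont_def)
    have quot: "L (D (slice qi z)) = (L (?f z) - L (?f w)) / (z - w)" if "z \<in> ?Z" "z \<noteq> w" for z
    proof -
      have ne: "slice qi z \<noteq> slice qi w"
        using that(2) norm_slice[OF qi_square, of "z - w"] by (auto simp: slice_diff)
      have "slice qi (z - w) * slice qi z = slice qi z * slice qi (z - w)"
        by (simp add: mult.commute flip: slice_mult[OF qi_square])
      then have "conj_act (slice qi z - slice qi w) (slice qi z) = slice qi z"
        using ne by (intro conj_act_eqI) (simp_all add: slice_diff)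
      then have "?f z - ?f w = D (slice qi z) * slice qi (z - w)"
        using F[of "slice qi z"] that(1) ne by (simp add: skew_prod_def slice_diff)
      then have "L (?f z) - L (?f w) = L (D (slice qi z)) * (z - w)"
        using L by (metis linear_diff)
      then show ?thesis
        using that(2) by simp
    qed
    have "\<forall>\<^sub>F z in at w. z \<in> ?Z \<and> z \<noteq> w"
      using eventually_at_in_open[OF \<open>open ?Z\<close> w] by (auto elim: eventually_mono)
    then have "\<forall>\<^sub>F z in at w. L (D (slice qi z)) = (L (?f z) - L (?f w)) / (z - w)"
      by eventually_elim (use quot in blast)
    with lim have "((\<lambda>z. (L (?f z) - L (?f w)) / (z - w)) \<longlongrightarrow> L (D (slice qi w))) (at w)"
      by (rule Lim_transform_eventually)
    then show "\<exists>f'. DERIV (\<lambda>z. L (?f z)) w :> f'"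
      unfolding has_field_derivative_iff by blast
  qed
  show "slice_holomorphic_on ?f ?Z"
    unfolding slice_holomorphic_on_def
    using *[OF linear_qfst qfst_mult_slice] *[OF linear_qsnd qsnd_mult_slice] by simp
qed

lemma skew_regular_representation:
  assumes "region U" "skew_regular_on U F" "I * I = - 1" "slice qi z \<in> U"
  shows "F (slice I z) = F (slice qi z) * rep1 I + F (slice qi (cnj z)) * rep2 I"
proof -
  define q where "q = slice qi z"
  have "skew_differentiable F U q"
    using assms(2,4) by (simp add: skew_regular_on_def q_def)
  then obtain D where F: "\<And>x. x \<in> U \<Longrightarrow> F x = F q + (D \<diamondop> (\<lambda>y. y - q)) x"
    unfolding skew_differentiable_def by blast
  have aff: "F x = (F q - D (qcnj q) * q) + D (qcnj q) * x" if "x \<in> orbit q" for x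
  proof (cases "x = q")
    case False
    then have "conj_act (x - q) x = qcnj q"
      using that by (simp add: orbit_iff conj_act_same_sphere)
    moreover have "x \<in> U"
      using that orbit_subset_region[OF assms(1,4)] by (auto simp: q_def)
    ultimately show ?thesis
      using F[of x] False by (simp add: skew_prod_def algebra_simps)
  qed simp
  have orb: "slice I z \<in> orbit q" "slice qi z \<in> orbit q" "slice qi (cnj z) \<in> orbit q"
    by (simp_all add: q_def orbit_iff qRe_slice norm_slice qi_square assms(3))
  show ?thesis
    unfolding aff[OF orb(1)] aff[OF orb(2)] aff[OF orb(3)] by (rule affine_rep)
qed

text \<open>Translation by a real number respects every slice, so the Taylor series in the slice of
  \<open>qi\<close>, spread by the representation formula, covers a full ball.\<close>

lemma skew_regular_real_expansion:
  assumes "region U" "skew_regular_on U F" "q \<in> U" "q \<in> \<real>"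
  obtains a V where "open V" "q \<in> V" "V \<subseteq> U" "\<And>x. x \<in> V \<Longrightarrow> (\<lambda>n. a n * (x - q) ^ n) sums F x"
proof -
  obtain r where r: "q = of_real r"
    using assms(4) by (auto elim: Reals_cases)
  have "open U"
    using assms(1) by (simp add: region_def)
  then obtain e where "e > 0" and e: "ball q e \<subseteq> U"
    using assms(3) open_contains_ball by blast
  have norm_shift: "norm (slice I (of_real r + s) - q) = norm s" if "I * I = - 1" for I s
    using that by (simp add: r slice_add norm_slice)
  have "slice qi (of_real r + s) \<in> U" if "s \<in> ball 0 e" for s
    using that norm_shift[OF qi_square, of s] e
    by (intro subsetD[OF e]) (simp add: dist_norm norm_minus_commute)
  then have "slice_holomorphic_on (\<lambda>s. F (slice qi (of_real r + s))) (ball 0 e)"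
    by (intro slice_holomorphic_on_compose[OF skew_regular_slice_holomorphic(1)[OF assms(1,2)]]
        holomorphic_intros image_subsetI) simp
  then obtain a where a: "\<And>I s. norm s < e \<Longrightarrow> (\<lambda>n. a n * slice I (s ^ n)) sums
      (F (slice qi (of_real r + s)) * rep1 I + F (slice qi (of_real r + cnj s)) * rep2 I)"
    by (rule slice_holomorphic_power_series) blast
  show thesis
  proof (rule that[of "ball q e" a])
    fix x assume x: "x \<in> ball q e"
    obtain I z where I: "I * I = - 1" and z: "x = slice I z"
      by (metis quat_cases_slice)
    define s where "s = z - of_real r"
    have zs: "z = of_real r + s"
      by (simp add: s_def)
    have "norm s < e"
      using x norm_shift[OF I, of s] by (simp add: z zs dist_norm norm_minus_commute)
    have "x \<in> U"
      using x e by auto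
    then have "slice qi z \<in> U"
      using region_slice_iff[OF assms(1) I qi_square] by (simp add: z)
    then have "F x = F (slice qi z) * rep1 I + F (slice qi (cnj z)) * rep2 I"
      unfolding z by (rule skew_regular_representation[OF assms(1,2) I])
    moreover have "x - q = slice I s"
      by (simp add: z zs r slice_add)
    ultimately show "(\<lambda>n. a n * (x - q) ^ n) sums F x"
      using a[OF \<open>norm s < e\<close>, of I] by (simp add: slice_power[OF I] zs)
  qed (use e \<open>e > 0\<close> in auto)
qed

lemma skew_regular_sphere_expansion:
  assumes "region U" "skew_regular_on U F" "q \<in> U" "q \<notin> \<real>"
  obtains a b V where "open V" "orbit q \<subseteq> V" "V \<subseteq> U"
    "\<And>x. x \<in> V \<Longrightarrow> summable (\<lambda>n. a n * orb_poly q x ^ n)"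
    "\<And>x. x \<in> V \<Longrightarrow> summable (\<lambda>n. b n * orb_poly q x ^ n)"
    "\<And>x. x \<in> V \<Longrightarrow> F x = (\<Sum>n. a n * orb_poly q x ^ n) + (\<Sum>n. b n * orb_poly q x ^ n) * x"
proof -
  define f where "f = (\<lambda>z. F (slice qi z))"
  define Z where "Z = {z. slice qi z \<in> U}"
  have f: "slice_holomorphic_on f Z" and "open Z"
    unfolding f_def Z_def using skew_regular_slice_holomorphic[OF assms(1,2)] by auto
  obtain J w where J: "J * J = - 1" "Im w \<ge> 0" and q: "q = slice J w"
    by (metis quat_cases_slice)
  have v: "Im w > 0"
  proof (rule ccontr)
    assume "\<not> Im w > 0"
    then have "q = of_real (Re w)"
      using J by (simp add: q slice_def)
    then show False
      using assms(4) by simp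
  qed
  define P where "P = (\<lambda>z. (z - w) * (z - cnj w))"
  have P: "orb_poly q (slice I z) = slice I (P z)" if "I * I = - 1" for I z
    unfolding P_def q by (rule orb_poly_slice[OF that J(1)])
  \<comment> \<open>The completed square, from which the local inverses below are read off.\<close>
  have P_square: "P z = (z - of_real (Re w))\<^sup>2 + of_real ((Im w)\<^sup>2)" for z
    by (simp add: P_def complex_eq_iff power2_eq_square algebra_simps)
  have P_cnj: "P (cnj z) = cnj (P z)" for z
    by (simp add: P_square)

  text \<open>\<open>g1\<close> and \<open>g2\<close> are the branches of the inverse of \<open>P\<close> near \<open>w\<close> and \<open>cnj w\<close>.\<close>
  define R where "R = (\<lambda>t. csqrt (of_real ((Im w)\<^sup>2) - t))"
  define g1 where "g1 = (\<lambda>t. of_real (Re w) + \<i> * R t)"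
  define g2 where "g2 = (\<lambda>t. of_real (Re w) - \<i> * R t)"
  \<comment> \<open>This radius keeps the argument of \<open>csqrt\<close> in the right half-plane,
    away from the branch cut and from 0, where the two branches would meet.\<close>
  have nonpos: "of_real ((Im w)\<^sup>2) - t \<notin> \<real>\<^sub>\<le>\<^sub>0" if "norm t < (Im w)\<^sup>2" for t :: complex
  proof -
    have "Re t < (Im w)\<^sup>2"
      using that complex_Re_le_cmod[of t] by linarith
    then show ?thesis
      by (auto simp: complex_nonpos_Reals_iff)
  qed
  have R_hol: "R holomorphic_on ball 0 ((Im w)\<^sup>2)"
    unfolding R_def using nonpos by (intro holomorphic_intros) auto
  have R_nz: "R t \<noteq> 0" if "norm t < (Im w)\<^sup>2" for t
    using nonpos[OF that] by (auto simp: R_def)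
  have g_hol: "g1 holomorphic_on ball 0 ((Im w)\<^sup>2)" "g2 holomorphic_on ball 0 ((Im w)\<^sup>2)"
    unfolding g1_def g2_def by (intro holomorphic_intros R_hol)+
  have "R 0 = of_real (Im w)"
    using v by (simp add: R_def flip: of_real_power)
  then have g0: "g1 0 = w" "g2 0 = cnj w"
    by (simp_all add: g1_def g2_def complex_eq_iff)
  have "w \<in> Z"
    using assms(3) region_slice_iff[OF assms(1) J(1) qi_square] by (simp add: Z_def q)
  then have "cnj w \<in> Z"
    using slice_cnj_in_region[OF assms(1)] by (simp add: Z_def)
  define N where "N = (ball 0 ((Im w)\<^sup>2) \<inter> g1 -` Z) \<inter> (ball 0 ((Im w)\<^sup>2) \<inter> g2 -` Z)"
  have "open N"
    unfolding N_def using g_hol \<open>open Z\<close>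
    by (intro open_Int continuous_open_preimage holomorphic_on_imp_continuous_on) auto
  moreover have "0 \<in> N"
    using v g0 \<open>w \<in> Z\<close> \<open>cnj w \<in> Z\<close> by (simp add: N_def)
  ultimately obtain e where "e > 0" and e: "ball 0 e \<subseteq> N"
    using open_contains_ball by blast
  have e_v: "ball (0::complex) e \<subseteq> ball 0 ((Im w)\<^sup>2)"
    using e unfolding N_def by blast
  have g_in: "g1 ` ball 0 e \<subseteq> Z" "g2 ` ball 0 e \<subseteq> Z"
    using e by (auto simp: N_def)
  have g_hol': "g1 holomorphic_on ball 0 e" "g2 holomorphic_on ball 0 e"
    using g_hol e_v by (auto intro: holomorphic_on_subset)
  have g_diff: "g1 t - g2 t \<noteq> 0" if "t \<in> ball 0 e" for t
    using R_nz[of t] that e_v by (auto simp: g1_def g2_def)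
  have inv_P: "z = g1 (P z) \<or> z = g2 (P z)" for z
  proof -
    have "(z - of_real (Re w))\<^sup>2 = (\<i> * R (P z))\<^sup>2"
      by (simp add: power_mult_distrib R_def P_square)
    then show ?thesis
      unfolding power2_eq_iff by (auto simp: g1_def g2_def algebra_simps)
  qed

  \<comment> \<open>\<open>B\<close> is the divided difference of \<open>f\<close> at the two roots
    of \<open>P z = t\<close>; together with \<open>A\<close> it solves the two linear equations for
    the values there.\<close>
  define B where "B = (\<lambda>t. (f (g1 t) - f (g2 t)) * slice qi (1 / (g1 t - g2 t)))"
  define A where "A = (\<lambda>t. f (g1 t) - B t * slice qi (g1 t))"
  have fg: "slice_holomorphic_on (\<lambda>t. f (g1 t)) (ball 0 e)" "slice_holomorphic_on (\<lambda>t. f (g2 t)) (ball 0 e)"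
    by (intro slice_holomorphic_on_compose[OF f] g_hol' g_in)+
  have B_hol: "slice_holomorphic_on B (ball 0 e)"
    unfolding B_def using g_diff
    by (intro slice_holomorphic_on_mult slice_holomorphic_on_diff fg holomorphic_intros g_hol') auto
  have A_hol: "slice_holomorphic_on A (ball 0 e)"
    unfolding A_def by (intro slice_holomorphic_on_mult slice_holomorphic_on_diff fg g_hol' B_hol)
  have f_eq: "f z = A (P z) + B (P z) * slice qi z" and z_in: "z \<in> Z" if "norm (P z) < e" for z
  proof -
    define t where "t = P z"
    have t: "t \<in> ball 0 e"
      using that by (simp add: t_def)
    have "B t * slice qi (g1 t - g2 t) = f (g1 t) - f (g2 t)"
      using g_diff[OF t] slice_of_real[of qi 1]
      by (simp add: B_def mult.assoc flip: slice_mult[OF qi_square])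
    then have "f (g2 t) = A t + B t * slice qi (g2 t)"
      by (simp add: A_def slice_diff algebra_simps)
    moreover have "f (g1 t) = A t + B t * slice qi (g1 t)"
      by (simp add: A_def)
    ultimately show "f z = A (P z) + B (P z) * slice qi z"
      using inv_P[of z] unfolding t_def by metis
    show "z \<in> Z"
      using inv_P[of z] g_in t unfolding t_def by (metis imageI subsetD)
  qed
  obtain a where a: "\<And>I s. norm s < e \<Longrightarrow>
      (\<lambda>n. a n * slice I (s ^ n)) sums (A s * rep1 I + A (cnj s) * rep2 I)"
    using slice_holomorphic_power_series[OF A_hol] by blast
  obtain b where b: "\<And>I s. norm s < e \<Longrightarrow>
      (\<lambda>n. b n * slice I (s ^ n)) sums (B s * rep1 I + B (cnj s) * rep2 I)"
    using slice_holomorphic_power_series[OF B_hol] by blast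

  \<comment> \<open>In each slice this is the condition \<open>norm (P z) < e\<close>, which is
    symmetric under \<open>cnj\<close>, so both points used by the representation formula are
    covered.\<close>
  define V where "V = {x. norm (orb_poly q x) < e}"
  have V: "x \<in> U" "summable (\<lambda>n. a n * orb_poly q x ^ n)" "summable (\<lambda>n. b n * orb_poly q x ^ n)"
    "F x = (\<Sum>n. a n * orb_poly q x ^ n) + (\<Sum>n. b n * orb_poly q x ^ n) * x"
    if "x \<in> V" for x
  proof -
    obtain I z where I: "I * I = - 1" and x: "x = slice I z"
      by (metis quat_cases_slice)
    have Pz: "norm (P z) < e" "norm (P (cnj z)) < e"
      using that by (simp_all add: V_def x P[OF I] norm_slice[OF I] P_cnj)
    have z: "slice qi z \<in> U"
      using z_in[OF Pz(1)] by (simp add: Z_def)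
    then show "x \<in> U"
      using region_slice_iff[OF assms(1) I qi_square] by (simp add: x)
    have sa: "(\<lambda>n. a n * orb_poly q x ^ n) sums (A (P z) * rep1 I + A (P (cnj z)) * rep2 I)"
      and sb: "(\<lambda>n. b n * orb_poly q x ^ n) sums (B (P z) * rep1 I + B (P (cnj z)) * rep2 I)"
      using a[OF Pz(1), of I] b[OF Pz(1), of I] by (simp_all add: x P[OF I] slice_power[OF I] P_cnj)
    show "summable (\<lambda>n. a n * orb_poly q x ^ n)" "summable (\<lambda>n. b n * orb_poly q x ^ n)"
      using sa sb by (simp_all add: sums_iff)
    have "F x = f z * rep1 I + f (cnj z) * rep2 I"
      unfolding x f_def by (rule skew_regular_representation[OF assms(1,2) I z])
    \<comment> \<open>By \<open>rep_mult_slice\<close>, the factors \<open>slice qi z\<close> and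
      \<open>slice qi (cnj z)\<close> both become the single right factor \<open>x\<close>.\<close>
    also have "\<dots> = (A (P z) * rep1 I + A (P (cnj z)) * rep2 I)
        + (B (P z) * rep1 I + B (P (cnj z)) * rep2 I) * x"
      unfolding f_eq[OF Pz(1)] f_eq[OF Pz(2)] x
      by (simp add: distrib_right mult.assoc rep_mult_slice[OF I])
    finally show "F x = (\<Sum>n. a n * orb_poly q x ^ n) + (\<Sum>n. b n * orb_poly q x ^ n) * x"
      using sa sb by (simp add: sums_iff)
  qed
  show thesis
  proof (rule that[of V a b])
    show "open V"
      unfolding V_def by (intro open_Collect_less continuous_intros continuous_orb_poly)
    show "orbit q \<subseteq> V"
      using \<open>e > 0\<close> by (auto simp: V_def orb_poly_eq_0_iff[THEN iffD2])
    show "V \<subseteq> U"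
      using V(1) by auto
  qed (use V in auto)
qed

lemma skew_regular_imp_symmetrically_analytic:
  assumes "region U" "skew_regular_on U F"
  shows "symmetrically_analytic_on U F"
  unfolding symmetrically_analytic_on_def
proof (intro ballI impI conjI)
  fix S assume "S \<in> range orbit" "S \<subseteq> U"
  then obtain q where S: "S = orbit q" and q: "q \<in> U"
    using self_in_orbit by blast
  {
    assume "trivial_orbit S"
    then have "q \<in> \<real>"
      by (simp add: S trivial_orbit_iff)
    then obtain a V where "open V" "q \<in> V" "V \<subseteq> U"
      "\<And>x. x \<in> V \<Longrightarrow> (\<lambda>n. a n * (x - q) ^ n) sums F x"
      by (rule skew_regular_real_expansion[OF assms q]) blast
    then show "\<exists>a V. open V \<and> S \<subseteq> V \<and> V \<subseteq> U \<and> spherical_convergent_on S a V \<and>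
        (\<forall>x\<in>V. F x = spherical_series S a x)"
      unfolding S orbit_of_real[OF \<open>q \<in> \<real>\<close>]
      by (intro exI[of _ a] exI[of _ V])
        (simp add: orbit_poly_trivial spherical_convergent_on_def spherical_series_def sums_iff)
  }
  {
    assume "\<not> trivial_orbit S"
    then have "q \<notin> \<real>"
      by (simp add: S trivial_orbit_iff)
    then obtain a b V where "open V" "orbit q \<subseteq> V" "V \<subseteq> U"
      "\<And>x. x \<in> V \<Longrightarrow> summable (\<lambda>n. a n * orb_poly q x ^ n)"
      "\<And>x. x \<in> V \<Longrightarrow> summable (\<lambda>n. b n * orb_poly q x ^ n)"
      "\<And>x. x \<in> V \<Longrightarrow> F x = (\<Sum>n. a n * orb_poly q x ^ n) + (\<Sum>n. b n * orb_poly q x ^ n) * x"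
      by (rule skew_regular_sphere_expansion[OF assms q]) blast
    then show "\<exists>a b V. open V \<and> S \<subseteq> V \<and> V \<subseteq> U \<and>
        spherical_convergent_on S a V \<and> spherical_convergent_on S b V \<and>
        (\<forall>x\<in>V. F x = spherical_series S a x + (spherical_series S b \<diamondop> (\<lambda>y. y)) x)"
      unfolding S
      by (intro exI[of _ a] exI[of _ b] exI[of _ V])
        (auto simp: orbit_poly_eq[OF \<open>q \<notin> \<real>\<close>] spherical_convergent_on_def spherical_series_def skew_prod_ident)
  }
qed

theorem theorem3p26:
  fixes U :: "quat set" and F :: "quat \<Rightarrow> quat"
  assumes "region U"
  shows "skew_regular_on U F \<longleftrightarrow> symmetrically_analytic_on U F"
  using skew_regular_imp_symmetrically_analytic[OF assms]
    symmetrically_analytic_imp_skew_regular[OF assms] by blast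

end
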